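(* Let $G$ be a group with a norm $\|\cdot\|$. Let $\varphi\colon \mathbb{R}_+\to\mathbb{R}_+$ be an increasing function such that $\int_1^\infty \frac{\varphi(t)}{t^2}\,dt<\infty$. Let $f\colon G\to\mathbb{R}$ be a function such that $$|f(g)-f(gh)+f(h)|\le \varphi(\|g\|+\|h\|)\quad\text{for all } g,h\in G.$$ Then for every $g\in G$ the limit $$\widehat f(g)=\lim_{n\to\infty}\frac{f(g^n)}{n}$$ exists (as a real number); that is, $f$ admits a homogenisation $\widehat f\colon G\to\mathbb{R}$.
   Context: Here $\mathbb{R}_+=[0,\infty)$. A norm on a group $G$ is a function $\|\cdot\|\colon G\to\mathbb{R}$ such that for all $g,h\in G$: $\|g\|\ge 0$ with $\|g\|=0$ if and only if $g=1$; $\|g^{-1}\|=\|g\|$; and $\|gh\|\le\|g\|+\|h\|$. The homogenisation of a function $f\colon G\to\mathbb{R}$ is the function $\widehat f(g)=\lim_{n\to\infty} f(g^n)/n$, provided that these limits exist. *)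

theory Defs
  imports "HOL-Analysis.Analysis" "HOL-Algebra.Group"
begin

definition group_norm :: "('a, 'b) monoid_scheme \<Rightarrow> ('a \<Rightarrow> real) \<Rightarrow> bool" where
  "group_norm G N \<longleftrightarrow>
     (\<forall>g\<in>carrier G. 0 \<le> N g) \<and>
     (\<forall>g\<in>carrier G. N g = 0 \<longleftrightarrow> g = \<one>\<^bsub>G\<^esub>) \<and>
     (\<forall>g\<in>carrier G. N (inv\<^bsub>G\<^esub> g) = N g) \<and>
     (\<forall>g\<in>carrier G. \<forall>h\<in>carrier G. N (g \<otimes>\<^bsub>G\<^esub> h) \<le> N g + N h)"

text \<open>
  The value is meaningful only where the limit exists, since \<^const>\<open>lim\<close> is a total function.
\<close>

definition homogenisation :: "('a, 'b) monoid_scheme \<Rightarrow> ('a \<Rightarrow> real) \<Rightarrow> 'a \<Rightarrow> real" where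
  "homogenisation G f g = lim (\<lambda>n::nat. f (g [^]\<^bsub>G\<^esub> n) / real n)"

definition admits_homogenisation :: "('a, 'b) monoid_scheme \<Rightarrow> ('a \<Rightarrow> real) \<Rightarrow> bool" where
  "admits_homogenisation G f \<longleftrightarrow>
     (\<forall>g\<in>carrier G. (\<lambda>n::nat. f (g [^]\<^bsub>G\<^esub> n) / real n) \<longlonglongrightarrow> homogenisation G f g)"

end

theory Submission
  imports Defs
begin

text \<open>
  Along the powers of a fixed \<open>g\<close> the norm grows at most linearly, so \<open>a n = f (g^n)\<close> is an almost
  additive sequence: \<open>a m - a (m + n) + a n\<close> is bounded in absolute value by \<open>\<psi> (m + n)\<close>, where
  \<open>\<psi> n = \<phi> (c * n)\<close> is again increasing and \<open>c \<ge> 1\<close> is any constant that is at least \<open>\<parallel>g\<parallel>\<close>.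
  The integral condition, cut at the points \<open>c * 2^k\<close>, implies that \<open>\<psi> (2^k) / 2^k\<close> is summable
  (lemma \<open>summable_dyadic_if_integrable\<close>). The claim is therefore the
  two-sided form of a theorem of de Bruijn and Erdos on subadditive sequences with an error term
  (lemma \<open>convergent_quotient_if_almost_additive\<close>).

  That theorem rests on powers of two alone. Taking \<open>m = n = 2^k\<close> shows that consecutive
  terms of \<open>a (2^k) / 2^k\<close> differ by at most \<open>\<psi> (2^(k+1)) / 2^(k+1)\<close>, so this sequence has a
  limit \<open>L\<close>. Subtracting \<open>L * n\<close> from \<open>a n\<close> preserves almost additivity and reduces to \<open>L = 0\<close>. To
  reach general \<open>n\<close>, the binary digits of \<open>n\<close> are removed from the top: removing the digit \<open>2^k\<close>
  costs, relative to \<open>2^k\<close>, an error that tends to \<open>0\<close> as \<open>k\<close> grows, and the digits add up to \<open>n\<close>. So,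
  for every \<open>\<epsilon> > 0\<close>, the total error is at most a constant plus \<open>\<epsilon> * n\<close>
  (lemma \<open>quotient_tendsto_zero_if_dyadic\<close>).
\<close>

text \<open>
  On the interval from \<open>c * 2^k\<close> to \<open>c * 2^(k+1)\<close> the integrand is at least the value of \<open>\<phi>\<close> at the
  left end divided by the square of the right end. The integral of this step function over the
  interval is the \<open>k\<close>-th term of the series divided by \<open>4 * c\<close>. The intervals are disjoint, and
  \<open>c \<ge> 1\<close> keeps all of them inside the domain of integration.
\<close>

lemma summable_dyadic_if_integrable:
  fixes \<phi> :: "real \<Rightarrow> real"
  assumes nonneg: "\<And>t. 0 \<le> t \<Longrightarrow> 0 \<le> \<phi> t"
    and mono: "mono_on {0..} \<phi>"
    and int: "(\<integral>\<^sup>+ t \<in> {1..}. ennreal (\<phi> t / t\<^sup>2) \<partial>lborel) < \<infinity>"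
    and c: "1 \<le> c"
  shows "summable (\<lambda>k. \<phi> (c * 2 ^ k) / 2 ^ k)"
proof -
  define d where "d k = \<phi> (c * 2 ^ k) / (c * 2 ^ Suc k)\<^sup>2" for k
  define I where "I k = {c * 2 ^ k..<c * 2 ^ Suc k}" for k
  have d_nonneg: "0 \<le> d k" for k
    using nonneg c by (simp add: d_def)
  have step: "(\<Sum>k<n. ennreal (d k) * indicator (I k) t)
      \<le> ennreal (\<phi> t / t\<^sup>2) * indicator {1..<c * 2 ^ n} t" for n t
  proof (induction n)
    case 0
    show ?case by simp
  next
    case (Suc n)
    have c2: "1 \<le> c * 2 ^ n"
      using c mult_mono[of 1 c 1 "2 ^ n"] by simp
    show ?case
    proof (cases "t \<in> I n")
      case True
      then have t: "c * 2 ^ n \<le> t" "t < c * 2 ^ Suc n" by (auto simp: I_def)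
      have "\<phi> (c * 2 ^ n) \<le> \<phi> t"
        using t c2 by (intro mono_onD[OF mono]) auto
      moreover have "t\<^sup>2 \<le> (c * 2 ^ Suc n)\<^sup>2"
        using t c2 by (intro power_mono) auto
      ultimately have "d n \<le> \<phi> t / t\<^sup>2"
        unfolding d_def using t c2 by (intro frac_le nonneg) auto
      moreover have "(\<Sum>k<n. ennreal (d k) * indicator (I k) t) = 0"
        using Suc t by simp
      ultimately show ?thesis
        using True t c2 by (simp add: ennreal_leI)
    next
      case False
      have "indicator {1..<c * 2 ^ n} t \<le> (indicator {1..<c * 2 ^ Suc n} t :: ennreal)"
        using c2 by (auto simp: indicator_def)
      then have "ennreal (\<phi> t / t\<^sup>2) * indicator {1..<c * 2 ^ n} t
          \<le> ennreal (\<phi> t / t\<^sup>2) * indicator {1..<c * 2 ^ Suc n} t"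
        by (intro mult_left_mono) auto
      with Suc False show ?thesis by (auto intro: order_trans)
    qed
  qed
  define J where "J = (\<integral>\<^sup>+ t \<in> {1..}. ennreal (\<phi> t / t\<^sup>2) \<partial>lborel)"
  have "(\<Sum>k<n. d k * (c * 2 ^ k)) \<le> enn2real J" for n
  proof -
    have len: "emeasure lborel (I k) = ennreal (c * 2 ^ k)" for k
      using c by (simp add: I_def)
    have "ennreal (\<Sum>k<n. d k * (c * 2 ^ k)) = (\<Sum>k<n. ennreal (d k) * emeasure lborel (I k))"
      using d_nonneg c by (simp add: len ennreal_mult' flip: sum_ennreal)
    also have "\<dots> = (\<integral>\<^sup>+ t. (\<Sum>k<n. ennreal (d k) * indicator (I k) t) \<partial>lborel)"
      by (subst nn_integral_sum) (simp_all add: I_def nn_integral_cmult_indicator)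
    also have "\<dots> \<le> J"
      unfolding J_def
    proof (rule nn_integral_mono)
      fix t
      have "ennreal (\<phi> t / t\<^sup>2) * indicator {1..<c * 2 ^ n} t
          \<le> ennreal (\<phi> t / t\<^sup>2) * indicator {1..} t"
        by (intro mult_left_mono) (auto simp: indicator_def)
      with step[where n = n and t = t]
      show "(\<Sum>k<n. ennreal (d k) * indicator (I k) t) \<le> ennreal (\<phi> t / t\<^sup>2) * indicator {1..} t"
        by (rule order_trans)
    qed
    finally have le: "ennreal (\<Sum>k<n. d k * (c * 2 ^ k)) \<le> J" .
    have "J < \<infinity>" using int by (simp add: J_def)
    with le have "ennreal (\<Sum>k<n. d k * (c * 2 ^ k)) \<le> ennreal (enn2real J)"
      by simp
    then show ?thesis by (simp add: ennreal_le_iff)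
  qed
  then have "summable (\<lambda>k. d k * (c * 2 ^ k))"
    using d_nonneg c by (intro summableI_nonneg_bounded[where x = "enn2real J"]) auto
  then have "summable (\<lambda>k. 4 * c * (d k * (c * 2 ^ k)))"
    by (rule summable_mult)
  moreover have "4 * c * (d k * (c * 2 ^ k)) = \<phi> (c * 2 ^ k) / 2 ^ k" for k
    using c by (simp add: d_def field_simps power2_eq_square)
  ultimately show ?thesis by simp
qed

text \<open>
  The step from powers of two to all \<open>n\<close>: once \<open>\<epsilon>\<close> absorbs both the size of \<open>b (2^k)\<close> and the
  defect at \<open>2^k\<close>, each removal of a leading binary digit \<open>2^k\<close> costs at most \<open>\<epsilon> * 2^k\<close>; the
  finitely many \<open>n\<close> below the threshold are absorbed by a constant.
\<close>

lemma quotient_tendsto_zero_if_dyadic: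
  fixes b \<psi> :: "nat \<Rightarrow> real"
  assumes defect: "\<And>m n. \<bar>b m - b (m + n) + b n\<bar> \<le> \<psi> (m + n)"
    and mono: "mono \<psi>"
    and \<psi>: "(\<lambda>k. \<psi> (2 ^ k) / 2 ^ k) \<longlonglongrightarrow> 0"
    and b: "(\<lambda>k. b (2 ^ k) / 2 ^ k) \<longlonglongrightarrow> 0"
  shows "(\<lambda>n. b n / n) \<longlonglongrightarrow> 0"
proof -
  define \<delta> where "\<delta> k = \<bar>b (2 ^ k) / 2 ^ k\<bar> + 2 * (\<psi> (2 ^ Suc k) / 2 ^ Suc k)" for k
  have "\<delta> \<longlonglongrightarrow> \<bar>0\<bar> + 2 * 0"
    unfolding \<delta>_def using b LIMSEQ_Suc[OF \<psi>] by (intro tendsto_intros)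
  then have \<delta>: "\<delta> \<longlonglongrightarrow> 0" by simp
  have strip: "\<bar>b (2 ^ k + r)\<bar> \<le> \<bar>b r\<bar> + \<delta> k * 2 ^ k" if "r < 2 ^ k" for k r
  proof -
    have "\<psi> (2 ^ k + r) \<le> \<psi> (2 ^ Suc k)"
      using that by (intro monoD[OF mono]) simp
    then have "\<bar>b (2 ^ k + r)\<bar> \<le> \<bar>b r\<bar> + (\<bar>b (2 ^ k)\<bar> + \<psi> (2 ^ Suc k))"
      using defect[of "2 ^ k" r] by linarith
    also have "\<bar>b (2 ^ k)\<bar> + \<psi> (2 ^ Suc k) = \<delta> k * 2 ^ k"
      by (simp add: \<delta>_def field_simps)
    finally show ?thesis .
  qed
  have linear: "\<exists>M. \<forall>n. \<bar>b n\<bar> \<le> M + e * n" if e: "e > 0" for e :: real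
  proof -
    obtain k0 where k0: "\<delta> k \<le> e" if "k \<ge> k0" for k
      using order_tendstoD(2)[OF \<delta> e] by (auto simp: eventually_sequentially intro: less_imp_le)
    define M where "M = (\<Sum>n<2 ^ k0. \<bar>b n\<bar>)"
    have "\<bar>b n\<bar> \<le> M + e * n" for n
    proof (induction n rule: less_induct)
      case (less n)
      show ?case
      proof (cases "n < 2 ^ k0")
        case True
        then have "\<bar>b n\<bar> \<le> M"
          unfolding M_def by (intro member_le_sum) auto
        moreover have "0 \<le> e * n" using e by simp
        ultimately show ?thesis by linarith
      next
        case False
        then have n: "0 < n" "2 ^ k0 \<le> n" by (auto intro: gr0I)
        obtain k where k: "2 ^ k \<le> n" "n < 2 ^ Suc k"
          using ex_power_ivl1[of 2 n] n by auto
        have "(2::nat) ^ k0 < 2 ^ Suc k" using n k by linarith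
        then have "k0 \<le> k" by (simp only: power_strict_increasing_iff)
        define r where "r = n - 2 ^ k"
        have n_eq: "n = 2 ^ k + r" and r: "r < 2 ^ k"
          using k by (auto simp: r_def)
        have "\<bar>b n\<bar> \<le> \<bar>b r\<bar> + \<delta> k * 2 ^ k"
          unfolding n_eq by (rule strip[OF r])
        also have "\<dots> \<le> (M + e * r) + e * 2 ^ k"
          using less.IH[of r] k0[OF \<open>k0 \<le> k\<close>] by (intro add_mono mult_right_mono) (auto simp: n_eq)
        also have "\<dots> = M + e * n" by (simp add: n_eq algebra_simps)
        finally show ?thesis .
      qed
    qed
    then show ?thesis by blast
  qed
  show ?thesis
  proof (rule LIMSEQ_I)
    fix e :: real
    assume e: "e > 0"
    then obtain M where M: "\<bar>b n\<bar> \<le> M + e / 2 * n" for n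
      using linear[of "e / 2"] by auto
    obtain n0 :: nat where n0: "M < n0 * (e / 2)"
      using reals_Archimedean3[of "e / 2"] e by auto
    have "norm (b n / n - 0) < e" if "n \<ge> Suc n0" for n
    proof -
      have "n0 * (e / 2) \<le> n * (e / 2)"
        using that e by (intro mult_right_mono) auto
      then have "\<bar>b n\<bar> < e * n" using M[of n] n0 by (simp add: field_simps)
      then show ?thesis using that by (simp add: abs_divide pos_divide_less_eq)
    qed
    then show "\<exists>n0. \<forall>n\<ge>n0. norm (b n / n - 0) < e" by blast
  qed
qed

lemma convergent_quotient_if_almost_additive:
  fixes a \<psi> :: "nat \<Rightarrow> real"
  assumes defect: "\<And>m n. \<bar>a m - a (m + n) + a n\<bar> \<le> \<psi> (m + n)"
    and mono: "mono \<psi>"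
    and summable: "summable (\<lambda>k. \<psi> (2 ^ k) / 2 ^ k)"
  shows "convergent (\<lambda>n. a n / n)"
proof -
  define q where "q k = a (2 ^ k) / 2 ^ k" for k
  have q: "norm (q (Suc k) - q k) \<le> \<psi> (2 ^ Suc k) / 2 ^ Suc k" for k
  proof -
    have "2 ^ k + 2 ^ k = (2 ^ Suc k :: nat)" by simp
    then have d: "\<bar>2 * a (2 ^ k) - a (2 ^ Suc k)\<bar> \<le> \<psi> (2 ^ Suc k)"
      using defect[of "2 ^ k" "2 ^ k"] by (simp del: power_Suc)
    have "q (Suc k) - q k = - (2 * a (2 ^ k) - a (2 ^ Suc k)) / 2 ^ Suc k"
      by (simp add: q_def diff_divide_distrib)
    then have "norm (q (Suc k) - q k) = \<bar>2 * a (2 ^ k) - a (2 ^ Suc k)\<bar> / 2 ^ Suc k"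
      by (simp only: real_norm_def abs_divide abs_minus_cancel power_abs abs_numeral)
    then show ?thesis
      using divide_right_mono[OF d, of "2 ^ Suc k"] by simp
  qed
  have "summable (\<lambda>k. \<psi> (2 ^ Suc k) / 2 ^ Suc k)"
    using summable by (subst summable_Suc_iff)
  then have "summable (\<lambda>k. q (Suc k) - q k)"
    by (rule summable_comparison_test'[where N = 0]) (rule q)
  then obtain s where "(\<lambda>n. \<Sum>k<n. q (Suc k) - q k) \<longlonglongrightarrow> s"
    using summable_LIMSEQ by blast
  then have "(\<lambda>n. (q n - q 0) + q 0) \<longlonglongrightarrow> s + q 0"
    by (intro tendsto_add) (simp_all add: sum_lessThan_telescope)
  then obtain L where L: "q \<longlonglongrightarrow> L" by auto
  define b where "b n = a n - L * n" for n :: nat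
  have "(\<lambda>n. b n / n) \<longlonglongrightarrow> 0"
  proof (rule quotient_tendsto_zero_if_dyadic[where \<psi> = \<psi>])
    show "\<bar>b m - b (m + n) + b n\<bar> \<le> \<psi> (m + n)" for m n
      using defect[of m n] by (simp add: b_def algebra_simps)
    show "(\<lambda>k. b (2 ^ k) / 2 ^ k) \<longlonglongrightarrow> 0"
      using LIM_zero[OF L] by (simp add: b_def q_def diff_divide_distrib)
  qed (use mono summable_LIMSEQ_zero[OF summable] in auto)
  then have "(\<lambda>n. b n / n + L) \<longlonglongrightarrow> 0 + L"
    by (intro tendsto_intros)
  moreover have "\<forall>\<^sub>F n in sequentially. b n / n + L = a n / n"
    using eventually_gt_at_top[of 0] by eventually_elim (simp add: b_def field_simps)
  ultimately have "(\<lambda>n. a n / n) \<longlonglongrightarrow> 0 + L"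
    by (rule Lim_transform_eventually)
  then show ?thesis by (rule convergentI)
qed

lemma group_norm_pow_le:
  assumes "group G" "group_norm G N" "g \<in> carrier G"
  shows "N (g [^]\<^bsub>G\<^esub> (n::nat)) \<le> n * N g"
proof -
  interpret group G by fact
  show ?thesis
  proof (induction n)
    case 0
    have "N \<one>\<^bsub>G\<^esub> = 0"
      using assms(2) one_closed unfolding group_norm_def by blast
    then show ?case by simp
  next
    case (Suc n)
    have "N (g [^]\<^bsub>G\<^esub> Suc n) \<le> N (g [^]\<^bsub>G\<^esub> n) + N g"
      using assms by (simp add: group_norm_def)
    with Suc show ?case by (simp add: algebra_simps)
  qed
qed

theorem proposition1p8:
  fixes G :: "('a, 'b) monoid_scheme"
    and N :: "'a \<Rightarrow> real"
    and \<phi> :: "real \<Rightarrow> real"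
    and f :: "'a \<Rightarrow> real"
  assumes "group G"
    and "group_norm G N"
    and "\<phi> \<in> {0..} \<rightarrow> {0..}"
    and "mono_on {0..} \<phi>"
    and "(\<integral>\<^sup>+ t \<in> {1..}. ennreal (\<phi> t / t\<^sup>2) \<partial>lborel) < \<infinity>"
    and "\<And>g h. g \<in> carrier G \<Longrightarrow> h \<in> carrier G \<Longrightarrow>
           \<bar>f g - f (g \<otimes>\<^bsub>G\<^esub> h) + f h\<bar> \<le> \<phi> (N g + N h)"
  shows "admits_homogenisation G f"
  unfolding admits_homogenisation_def homogenisation_def
proof
  interpret group G by fact
  fix g
  assume g: "g \<in> carrier G"
  have N_nonneg: "0 \<le> N h" if "h \<in> carrier G" for h
    using assms(2) that by (simp add: group_norm_def)
  \<comment> \<open>The summand \<open>1\<close> makes the scale at least \<open>1\<close>, whatever the size of \<open>g\<close>.\<close>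
  define c where "c = N g + 1"
  have c: "1 \<le> c" using N_nonneg[OF g] by (simp add: c_def)
  have pow: "N (g [^]\<^bsub>G\<^esub> n) \<le> c * n" for n :: nat
    using group_norm_pow_le[OF assms(1,2) g, of n] by (simp add: c_def algebra_simps)
  have "convergent (\<lambda>n. f (g [^]\<^bsub>G\<^esub> n) / real n)"
  proof (rule convergent_quotient_if_almost_additive[where \<psi> = "\<lambda>n. \<phi> (c * n)"])
    fix m n :: nat
    have "\<bar>f (g [^]\<^bsub>G\<^esub> m) - f (g [^]\<^bsub>G\<^esub> (m + n)) + f (g [^]\<^bsub>G\<^esub> n)\<bar>
        \<le> \<phi> (N (g [^]\<^bsub>G\<^esub> m) + N (g [^]\<^bsub>G\<^esub> n))"
      using assms(6)[of "g [^]\<^bsub>G\<^esub> m" "g [^]\<^bsub>G\<^esub> n"] g by (simp add: nat_pow_mult)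
    also have "\<dots> \<le> \<phi> (c * (m + n))"
      using pow[of m] pow[of n] N_nonneg g c
      by (intro mono_onD[OF assms(4)]) (auto simp: algebra_simps)
    finally show "\<bar>f (g [^]\<^bsub>G\<^esub> m) - f (g [^]\<^bsub>G\<^esub> (m + n)) + f (g [^]\<^bsub>G\<^esub> n)\<bar>
        \<le> \<phi> (c * real (m + n))" by simp
  next
    show "mono (\<lambda>n::nat. \<phi> (c * n))"
      using c by (intro monoI mono_onD[OF assms(4)]) auto
  next
    have "summable (\<lambda>k. \<phi> (c * 2 ^ k) / 2 ^ k)"
      using assms(3-5) c by (intro summable_dyadic_if_integrable) auto
    then show "summable (\<lambda>k. \<phi> (c * real (2 ^ k)) / 2 ^ k)" by simp
  qed
  then show "(\<lambda>n. f (g [^]\<^bsub>G\<^esub> n) / real n) \<longlonglongrightarrow> lim (\<lambda>n. f (g [^]\<^bsub>G\<^esub> n) / real n)"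
    by (simp add: convergent_LIMSEQ_iff)
qed

end
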